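(* Let $G$ be a forest with $n$ vertices and $m$ edges, and write its Laplacian polynomial as $\psi(G,x)=\det(xI_n-L(G))=\sum_{k=0}^{n}(-1)^{n-k}c_k x^k$. Then $c_{n-6}(G)=\frac{1}{6!}\Big[64m^6-480m^5+720m^4+600m^3-360m^2-480m-720M_1^5-2160\alpha_{1,2}-720\alpha_{1,3}+540(M_1^2)^2-2340m^2M_1^2+2160mM_1^3-1080M_1^4+720M_2^1-240M_1^2M_1^3m-120M_1^6-720M_2^2+600M_1^2M_1^3+1680M_1^2m^3-810(M_1^2)^2m-1920M_1^3m^2+1620M_1^4m+3600M_2^1m-720\Theta_2-1260mM_1^2+720M_1^2+480M_1^3-240m^4M_1^2+320m^3M_1^3+360M_1^2M_2^1+90M_1^2M_1^4+180(M_1^2)^2m^2-360M_1^4m^2-1440M_2^1m^2+288M_1^5m+1440\alpha_{1,2}m+40(M_1^3)^2-15(M_1^2)^3\Big]$, where all invariants are evaluated at $G$.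
   Context: $L(G)=D(G)-A(G)$ is the Laplacian matrix (degree diagonal matrix minus adjacency matrix). For a vertex $v$, $\deg(v)$ is its degree. For real $\alpha$, $M_1^\alpha(G)=\sum_{v\in V(G)}\deg(v)^\alpha$; for real $\lambda$, $M_2^\lambda(G)=\sum_{uv\in E(G)}(\deg(u)\deg(v))^\lambda$; for reals $\lambda,\xi$, $\alpha_{\lambda,\xi}(G)=\sum_{uv\in E(G)}[\deg(u)^\lambda\deg(v)^\xi+\deg(u)^\xi\deg(v)^\lambda]$. $\Theta_2(G)=\sum \deg(u)\deg(w)$, the sum over all subgraphs of $G$ isomorphic to the path $P_3$ (each counted once), written $uvw$ with middle vertex $v$ and end vertices $u,w$. Products such as $M_1^2M_1^3$ or $(M_1^2)^2$ denote ordinary products of the numerical invariants. *)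

theory Defs
  imports
    "HOL-Analysis.Analysis"
    "HOL-Computational_Algebra.Polynomial"
begin

text \<open>
  A graph has the finite type \<open>'v\<close> as its vertex set (so isolated vertices are allowed) and is
  given by its set of edges, each edge being a set of two vertices.
\<close>

definition simple_graph :: "'v::finite set set \<Rightarrow> bool" where
  "simple_graph E \<longleftrightarrow> (\<forall>e\<in>E. card e = 2)"

definition graph_cycle :: "'v::finite set set \<Rightarrow> 'v list \<Rightarrow> bool" where
  "graph_cycle E vs \<longleftrightarrow> length vs \<ge> 3 \<and> distinct vs \<and>
     (\<forall>i<length vs. {vs ! i, vs ! ((i + 1) mod length vs)} \<in> E)"

definition forest :: "'v::finite set set \<Rightarrow> bool" where
  "forest E \<longleftrightarrow> simple_graph E \<and> (\<nexists>vs. graph_cycle E vs)"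

definition deg :: "'v::finite set set \<Rightarrow> 'v \<Rightarrow> nat" where
  "deg E v = card {e \<in> E. v \<in> e}"

definition degree_matrix :: "'v::finite set set \<Rightarrow> real^'v^'v" where
  "degree_matrix E = (\<chi> u v. if u = v then real (deg E u) else 0)"

definition adjacency_matrix :: "'v::finite set set \<Rightarrow> real^'v^'v" where
  "adjacency_matrix E = (\<chi> u v. if {u, v} \<in> E then 1 else 0)"

definition laplacian_matrix :: "'v::finite set set \<Rightarrow> real^'v^'v" where
  "laplacian_matrix E = degree_matrix E - adjacency_matrix E"

text \<open>\<open>[:0, 1:]\<close> is the indeterminate; the determinant is taken over the ring \<open>real poly\<close>.\<close>

definition laplacian_poly :: "'v::finite set set \<Rightarrow> real poly" where
  "laplacian_poly E =
     det (mat [:0, 1:] - (\<chi> u v. [:laplacian_matrix E $ u $ v:]) :: real poly^'v^'v)"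

text \<open>
  As \<open>0 powr a = 0\<close> for every \<open>a\<close>, isolated vertices contribute \<open>0\<close> to \<open>M1 E a\<close>; for \<open>a > 0\<close>
  this is the usual value.
\<close>

definition M1 :: "'v::finite set set \<Rightarrow> real \<Rightarrow> real" where
  "M1 E a = (\<Sum>v\<in>UNIV. real (deg E v) powr a)"

definition M2 :: "'v::finite set set \<Rightarrow> real \<Rightarrow> real" where
  "M2 E l = (\<Sum>e\<in>E. (\<Prod>v\<in>e. real (deg E v)) powr l)"

text \<open>For an edge \<open>e = {u, v}\<close> the two inner sums produce exactly the two terms
  \<open>deg(u)^l deg(v)^x\<close> and \<open>deg(v)^l deg(u)^x\<close>.\<close>

definition alpha :: "'v::finite set set \<Rightarrow> real \<Rightarrow> real \<Rightarrow> real" where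
  "alpha E l x =
     (\<Sum>e\<in>E. \<Sum>u\<in>e. \<Sum>v\<in>e - {u}. real (deg E u) powr l * real (deg E v) powr x)"

text \<open>A subgraph \<open>uvw\<close> isomorphic to the path on three vertices is represented by its middle vertex
  and the set of its two end vertices, \<open>(v, {u, w})\<close>, so that \<open>uvw\<close> and \<open>wvu\<close> are the same.\<close>

definition P3_subgraphs :: "'v::finite set set \<Rightarrow> ('v \<times> 'v set) set" where
  "P3_subgraphs E = {(v, {u, w}) | u v w. u \<noteq> w \<and> {u, v} \<in> E \<and> {v, w} \<in> E}"

definition Theta2 :: "'v::finite set set \<Rightarrow> real" where
  "Theta2 E = (\<Sum>(v, S)\<in>P3_subgraphs E. \<Prod>u\<in>S. real (deg E u))"

end

theory Submission
  imports Defs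
begin

text \<open>
  Newton's identities express \<open>c (n - 6)\<close> through the traces of \<open>L, L^2, ..., L^6\<close>. As \<open>L\<close> is symmetric,
  the trace of \<open>L^(j + k)\<close> is the sum of the entrywise products of \<open>L^j\<close> and \<open>L^k\<close>, so it suffices
  to know the entries up to \<open>L^3\<close>. The entry at \<open>(u, v)\<close> is a sum over non-backtracking walks from
  \<open>u\<close> to \<open>v\<close> of length at most three, weighted by polynomials in the degrees. A forest has at most
  one such walk between given vertices, hence products of entries are sums over walks as well, and
  these collapse to sums over vertices, edges and paths with two edges.
\<close>

subsection \<open>Newton's identities for the characteristic polynomial\<close>

text \<open>The matrix is written exactly as in \<open>laplacian_poly\<close>, which is therefore
  its determinant by mere unfolding.\<close>

definition char_mat :: "'a::idom^'n^'n \<Rightarrow> 'a poly^'n^'n" where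
  "char_mat A = mat [:0, 1:] - (\<chi> u v. [:A $ u $ v:])"

text \<open>The cofactor at \<open>(j, i)\<close> is taken as the determinant with row
  \<open>i\<close> replaced by a unit vector; this form suits the row linearity of
  \<open>det\<close>.\<close>

definition adjugate :: "'a::comm_ring_1^'n^'n \<Rightarrow> 'a^'n^'n" where
  "adjugate M = (\<chi> j i. det (\<chi> k. if k = i then axis j 1 else M $ k))"

definition mat_power :: "'a::semiring_1^'n^'n \<Rightarrow> nat \<Rightarrow> 'a^'n^'n" where
  "mat_power A k = ((**) A ^^ k) (mat 1)"

lemma mat_power_0: "mat_power A 0 = mat 1"
  by (simp add: mat_power_def)

lemma mat_power_Suc: "mat_power A (Suc k) = A ** mat_power A k"
  by (simp add: mat_power_def)

text \<open>Row linearity turns the entry at \<open>(k, i)\<close> into the determinant of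
  \<open>M\<close> with row \<open>i\<close> replaced by row \<open>k\<close>. For
  \<open>k = i\<close> this is \<open>det M\<close>; otherwise two rows agree.\<close>

lemma matrix_mult_adjugate:
  fixes M :: "'a::comm_ring_1^'n^'n"
  shows "M ** adjugate M = mat (det M)"
proof -
  have "(\<Sum>j\<in>UNIV. M $ k $ j * adjugate M $ j $ i) = (if k = i then det M else 0)" for k i
  proof -
    have "(\<Sum>j\<in>UNIV. M $ k $ j * adjugate M $ j $ i)
        = (\<Sum>j\<in>UNIV. det (\<chi> l. if l = i then M $ k $ j *s axis j 1 else M $ l))"
      unfolding adjugate_def by (subst det_row_mul) simp
    also have "\<dots> = det (\<chi> l. if l = i then (\<Sum>j\<in>UNIV. M $ k $ j *s axis j 1) else M $ l)"
      by (rule det_linear_row_sum[symmetric]) simp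
    also have "\<dots> = det (\<chi> l. if l = i then M $ k else M $ l)"
      by (simp only: basis_expansion)
    also have "\<dots> = (if k = i then det M else 0)"
    proof (cases "k = i")
      case True
      then have "(\<chi> l. if l = i then M $ k else M $ l) = M"
        by (simp add: vec_eq_iff)
      with True show ?thesis by simp
    next
      case False
      then show ?thesis
        by (auto intro!: det_identical_rows[of k i] simp: row_def vec_eq_iff)
    qed
    finally show ?thesis .
  qed
  then show ?thesis
    by (simp add: vec_eq_iff matrix_matrix_mult_def mat_def)
qed

text \<open>The product rule, applied to each term of the Leibniz formula, differentiates one factor
  at a time, that is, one row at a time.\<close>

lemma pderiv_det:
  fixes M :: "'a::idom poly^'n^'n"
  shows "pderiv (det M) = (\<Sum>i\<in>UNIV. det (\<chi> k. if k = i then (\<chi> j. pderiv (M $ i $ j)) else M $ k))"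
proof -
  have s: "pderiv (of_int z * q) = of_int z * pderiv q" for z and q :: "'a poly"
    by (simp add: of_int_poly pderiv_smult)
  have "pderiv (\<Prod>i\<in>UNIV. M $ i $ p i)
      = (\<Sum>i\<in>UNIV. \<Prod>k\<in>UNIV. (if k = i then (\<chi> j. pderiv (M $ i $ j)) else M $ k) $ p k)" for p
    unfolding pderiv_prod
  proof (rule sum.cong[OF refl])
    fix i :: 'n
    have "(\<Prod>k\<in>UNIV. (if k = i then (\<chi> j. pderiv (M $ i $ j)) else M $ k) $ p k)
       = pderiv (M $ i $ p i) * (\<Prod>k\<in>UNIV - {i}. (if k = i then (\<chi> j. pderiv (M $ i $ j)) else M $ k) $ p k)"
      by (subst prod.remove[of UNIV i]) auto
    also have "(\<Prod>k\<in>UNIV - {i}. (if k = i then (\<chi> j. pderiv (M $ i $ j)) else M $ k) $ p k)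
       = (\<Prod>k\<in>UNIV - {i}. M $ k $ p k)"
      by (rule prod.cong) auto
    finally show "(\<Prod>k\<in>UNIV - {i}. M $ k $ p k) * pderiv (M $ i $ p i)
      = (\<Prod>k\<in>UNIV. (if k = i then (\<chi> j. pderiv (M $ i $ j)) else M $ k) $ p k)"
      by (simp add: mult.commute)
  qed
  moreover have pderiv_sum: "pderiv (\<Sum>x\<in>S. f x) = (\<Sum>x\<in>S. pderiv (f x))"
    for S and f :: "('n \<Rightarrow> 'n) \<Rightarrow> 'a poly"
    using higher_pderiv_sum[of 1 f S] by simp
  ultimately show ?thesis
    unfolding det_def
    by (simp add: pderiv_sum s sum_distrib_left sum.swap[of _ "{p. p permutes UNIV}"])
qed

text \<open>Row \<open>i\<close> of \<open>char_mat A\<close> has derivative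
  \<open>axis i 1\<close>, so the summands in \<open>pderiv_det\<close> are the diagonal entries of
  the adjugate.\<close>

lemma trace_adjugate_char_mat:
  fixes A :: "'a::idom^'n^'n"
  shows "trace (adjugate (char_mat A)) = pderiv (det (char_mat A))"
proof -
  have "(\<chi> j. pderiv (char_mat A $ i $ j)) = axis i 1" for i
    by (simp add: vec_eq_iff char_mat_def mat_def axis_def pderiv_diff pderiv_pCons)
  then show ?thesis
    by (simp add: pderiv_det trace_def adjugate_def cong: if_cong)
qed

text \<open>The term of a permutation has degree at most its number of fixed points. Only the
  identity reaches \<open>CARD('n)\<close>, with a product of monic linear factors.\<close>

lemma det_char_mat_degree:
  fixes A :: "'a::idom^'n^'n"
  shows "degree (det (char_mat A)) \<le> CARD('n)" "coeff (det (char_mat A)) CARD('n) = 1"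
proof -
  define t where "t p = of_int (sign p) * (\<Prod>i\<in>UNIV. char_mat A $ i $ p i)" for p :: "'n \<Rightarrow> 'n"
  have dt: "det (char_mat A) = (\<Sum>p | p permutes UNIV. t p)"
    by (simp add: det_def t_def)
  have entry: "degree (char_mat A $ i $ j) \<le> (if i = j then 1 else 0)" for i j
    by (auto simp: char_mat_def mat_def intro!: degree_diff_le)
  have deg_t: "degree (t p) \<le> card {i. p i = i}" for p
  proof -
    have "degree (t p) \<le> degree (\<Prod>i\<in>UNIV. char_mat A $ i $ p i)"
      unfolding t_def by (rule order.trans[OF degree_mult_le]) simp
    also have "\<dots> \<le> (\<Sum>i\<in>UNIV. degree (char_mat A $ i $ p i))"
      using degree_prod_sum_le[of UNIV "\<lambda>i. char_mat A $ i $ p i"] by (simp add: comp_def)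
    also have "\<dots> \<le> (\<Sum>i\<in>UNIV. if i = p i then 1 else 0)"
      by (rule sum_mono) (rule entry)
    also have "\<dots> = card {i. p i = i}"
      by (simp add: sum.If_cases eq_commute)
    finally show ?thesis .
  qed
  have le: "card {i. p i = i} \<le> CARD('n)" for p :: "'n \<Rightarrow> 'n"
    by (rule card_mono) auto
  show "degree (det (char_mat A)) \<le> CARD('n)"
    unfolding dt by (rule degree_sum_le) (auto intro: order.trans[OF deg_t le])
  have "coeff (t p) CARD('n) = 0" if "p \<noteq> id" for p
  proof (rule coeff_eq_0)
    from that obtain i where "p i \<noteq> i" by (auto simp: fun_eq_iff)
    then have "card {i. p i = i} < CARD('n)"
      by (intro psubset_card_mono) auto
    with deg_t show "degree (t p) < CARD('n)" by (rule le_less_trans)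
  qed
  then have "coeff (det (char_mat A)) CARD('n) = (\<Sum>p | p permutes (UNIV::'n set). if p = id then coeff (t id) CARD('n) else 0)"
    unfolding dt coeff_sum by (intro sum.cong) auto
  also have "\<dots> = coeff (t id) CARD('n)"
    by (simp add: permutes_id)
  also have "t id = (\<Prod>i\<in>UNIV. [:- (A $ i $ i), 1:])"
    by (simp add: t_def sign_id char_mat_def mat_def)
  also have "coeff \<dots> CARD('n) = 1"
  proof -
    have "degree (\<Prod>i\<in>UNIV. [:- (A $ i $ i), 1:]) = CARD('n)"
      by (subst degree_prod_eq_sum_degree) auto
    moreover have "lead_coeff (\<Prod>i\<in>UNIV. [:- (A $ i $ i), 1:]) = 1"
      by (subst lead_coeff_prod) simp
    ultimately show ?thesis by simp
  qed
  finally show "coeff (det (char_mat A)) CARD('n) = 1" .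
qed

text \<open>
  Comparing coefficients in \<open>(x I - A) adj (x I - A) = p I\<close> gives the Faddeev--LeVerrier recursion
  for the coefficient matrices of \<open>x adj (x I - A)\<close>, whose traces are the coefficients of \<open>x p'\<close>.
\<close>

lemma newton_identity_char_mat:
  fixes A :: "'a::idom^'n^'n"
  assumes "k \<le> CARD('n)"
  shows "of_nat k * coeff (det (char_mat A)) (CARD('n) - k)
    = - (\<Sum>i<k. coeff (det (char_mat A)) (CARD('n) - i) * trace (mat_power A (k - i)))"
proof -
  let ?p = "det (char_mat A)" and ?N = "CARD('n)"
  \<comment> \<open>The factor \<open>[:0, 1:]\<close> shifts the coefficients of the adjugate by
    one, so that the trace of \<open>C k\<close> is \<open>k\<close> times the coefficient of
    \<open>?p\<close> with the same index.\<close>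
  define C where "C k = (\<chi> i j. coeff ([:0, 1:] * adjugate (char_mat A) $ i $ j) k)" for k
  have trC: "trace (C k) = of_nat k * coeff ?p k" for k
  proof -
    have "trace (C k) = coeff ([:0, 1:] * trace (adjugate (char_mat A))) k"
      by (simp add: trace_def C_def coeff_sum coeff_pCons split: nat.split)
    then show ?thesis
      by (simp add: trace_adjugate_char_mat coeff_pderiv coeff_pCons split: nat.split)
  qed
  have rec: "C k = A ** C (Suc k) + mat (coeff ?p k)" for k
  proof -
    have "C k $ i $ j = (A ** C (Suc k) + mat (coeff ?p k)) $ i $ j" for i j
    proof -
      let ?B = "adjugate (char_mat A)"
      have "(if i = j then ?p else 0) = (\<Sum>l\<in>UNIV. char_mat A $ i $ l * ?B $ l $ j)"
        using arg_cong[OF matrix_mult_adjugate[of "char_mat A"], of "\<lambda>M. M $ i $ j"]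
        by (simp add: mat_def matrix_matrix_mult_def)
      also have "\<dots> = (\<Sum>l\<in>UNIV. (if i = l then [:0, 1:] * ?B $ l $ j else 0) - [:A $ i $ l:] * ?B $ l $ j)"
        by (rule sum.cong) (auto simp: char_mat_def mat_def algebra_simps)
      also have "\<dots> = [:0, 1:] * ?B $ i $ j - (\<Sum>l\<in>UNIV. [:A $ i $ l:] * ?B $ l $ j)"
        by (simp add: sum_subtractf)
      finally have "coeff (if i = j then ?p else 0) k
         = coeff ([:0, 1:] * ?B $ i $ j - (\<Sum>l\<in>UNIV. [:A $ i $ l:] * ?B $ l $ j)) k"
        by (rule arg_cong)
      then show ?thesis
        by (auto simp: C_def mat_def matrix_matrix_mult_def coeff_sum split: if_splits)
    qed
    then show ?thesis by (simp add: vec_eq_iff)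
  qed
  \<comment> \<open>Beyond the largest degree \<open>D\<close> of the entries, \<open>C k\<close>
    vanishes trivially. The recursion carries this down to every index above \<open>?N\<close>,
    since \<open>?p\<close> has no coefficients there.\<close>
  have C0: "C k = 0" if "?N < k" for k
  proof -
    define D where "D = Max (range (\<lambda>(i, j). degree ([:0, 1:] * adjugate (char_mat A) $ i $ j)))"
    have big: "C k = 0" if "k > D" for k
    proof -
      have "degree ([:0, 1:] * adjugate (char_mat A) $ i $ j) \<le> D" for i j
        unfolding D_def by (rule Max_ge) (auto intro: rev_image_eqI[of "(i, j)"])
      with that show ?thesis
        unfolding C_def vec_eq_iff by (auto simp del: mult_pCons_left intro!: coeff_eq_0 intro: le_less_trans)
    qed
    show ?thesis
    proof (cases "k > D")
      case False
      then have "k \<le> Suc D" by simp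
      then show ?thesis using that
      proof (induction k rule: inc_induct)
        case base
        show ?case by (rule big) simp
      next
        case (step l)
        have "coeff ?p l = 0"
          using step.prems det_char_mat_degree(1)[of A] by (intro coeff_eq_0) simp
        moreover have "C (Suc l) = 0" using step by simp
        ultimately show ?case
          by (subst rec) (simp add: mat_def vec_eq_iff matrix_matrix_mult_def)
      qed
    qed (rule big)
  qed
  \<comment> \<open>The recursion is unrolled downwards from \<open>C (Suc ?N) = 0\<close>.\<close>
  have C_sum: "C (?N - j) = (\<Sum>i\<le>j. mat (coeff ?p (?N - i)) ** mat_power A (j - i))" if "j \<le> ?N" for j
    using that
  proof (induction j)
    case 0
    then show ?case
      using rec[of "?N"] C0[of "Suc ?N"] by (simp add: mat_power_0)
  next
    case (Suc j)
    have comm: "A ** (mat c ** M) = mat c ** (A ** M)" for c and M :: "'a^'n^'n"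
      by (simp add: vec_eq_iff matrix_matrix_mult_def mat_def if_distrib if_distribR sum_distrib_left mult.left_commute cong: if_cong)
    have dist: "A ** (\<Sum>i\<in>I. F i) = (\<Sum>i\<in>I. A ** F i)" for I and F :: "nat \<Rightarrow> 'a^'n^'n"
      by (induction I rule: infinite_finite_induct) (auto simp: matrix_add_ldistrib)
    have "C (?N - Suc j) = A ** C (?N - j) + mat (coeff ?p (?N - Suc j))"
      using rec[of "?N - Suc j"] Suc.prems by (simp add: Suc_diff_Suc)
    also have "A ** C (?N - j) = (\<Sum>i\<le>j. mat (coeff ?p (?N - i)) ** mat_power A (Suc j - i))"
      using Suc by (simp add: dist comm Suc_diff_le mat_power_Suc)
    finally show ?case by (simp add: mat_power_0)
  qed
  have tr_mult: "trace (mat c ** M) = c * trace M" for c and M :: "'a^'n^'n"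
    by (simp add: trace_def matrix_matrix_mult_def mat_def if_distrib if_distribR sum_distrib_left cong: if_cong)
  have tr_sum: "trace (\<Sum>i\<in>I. F i) = (\<Sum>i\<in>I. trace (F i))" for I and F :: "nat \<Rightarrow> 'a^'n^'n"
    by (simp add: trace_def sum.swap[of _ I])
  have "of_nat (?N - k) * coeff ?p (?N - k) = (\<Sum>i\<le>k. coeff ?p (?N - i) * trace (mat_power A (k - i)))"
    using arg_cong[OF C_sum[OF assms], of trace] by (simp add: tr_sum tr_mult trC)
  \<comment> \<open>The term for \<open>i = k\<close> contains the trace of the identity matrix,
    which is \<open>?N\<close>. Moving it to the left turns the factor \<open>?N - k\<close> into
    \<open>- k\<close>.\<close>
  also have "\<dots> = (\<Sum>i<k. coeff ?p (?N - i) * trace (mat_power A (k - i))) + coeff ?p (?N - k) * of_nat ?N"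
    by (simp add: lessThan_Suc_atMost[symmetric] mat_power_0 trace_I)
  finally show ?thesis
    using assms by (simp add: of_nat_diff algebra_simps eq_neg_iff_add_eq_0)
qed

section \<open>Traces of powers of a symmetric matrix\<close>

lemma mat_power_add: "mat_power A (j + k) = mat_power A j ** mat_power A k"
  by (induction j) (simp_all add: mat_power_0 mat_power_Suc matrix_mul_assoc)

lemma transpose_mat_power:
  fixes A :: "'a::comm_semiring_1^'n^'n"
  shows "transpose (mat_power A k) = mat_power (transpose A) k"
proof (induction k)
  case (Suc k)
  have "mat_power (transpose A) k ** transpose A = mat_power (transpose A) (k + 1)"
    unfolding mat_power_add by (simp add: mat_power_def)
  then show ?case
    using Suc by (simp add: mat_power_Suc matrix_transpose_mul)
qed (simp add: mat_power_0 transpose_mat)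

text \<open>Powers of a symmetric matrix are symmetric, so the second factor may be read at
  \<open>(u, v)\<close> instead of \<open>(v, u)\<close>.\<close>

lemma trace_symmetric_mat_power:
  fixes A :: "'a::comm_semiring_1^'n^'n"
  assumes "transpose A = A"
  shows "trace (mat_power A (j + k))
    = (\<Sum>u\<in>UNIV. \<Sum>v\<in>UNIV. mat_power A j $ u $ v * mat_power A k $ u $ v)"
proof -
  have "mat_power A k $ v $ u = mat_power A k $ u $ v" for u v
    using transpose_mat_power[of A k] assms by (metis transpose_def vec_lambda_beta)
  then show ?thesis
    by (simp add: mat_power_add trace_def matrix_matrix_mult_def)
qed

subsection \<open>Entries of powers of the Laplacian matrix\<close>

definition adj :: "'v::finite set set \<Rightarrow> 'v \<Rightarrow> 'v \<Rightarrow> real" where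
  "adj E u v = of_bool ({u, v} \<in> E)"

text \<open>This is the indicator of the non-backtracking walk \<open>u\<close>, \<open>w\<close>,
  \<open>v\<close>, with the arguments in the order of the walk.\<close>

definition path2 :: "'v::finite set set \<Rightarrow> 'v \<Rightarrow> 'v \<Rightarrow> 'v \<Rightarrow> real" where
  "path2 E u w v = adj E u w * adj E w v * of_bool (u \<noteq> v)"

text \<open>\<open>path3\<close> does not exclude \<open>u = v\<close>: triangles count as well, and vanish only in a forest.\<close>

definition path3 :: "'v::finite set set \<Rightarrow> 'v \<Rightarrow> 'v \<Rightarrow> 'v \<Rightarrow> 'v \<Rightarrow> real" where
  "path3 E u x y v = adj E u x * adj E x y * adj E y v * of_bool (u \<noteq> y) * of_bool (x \<noteq> v)"

text \<open>Every edge is met in both directions, which is the source of the factors 2 in the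
  evaluations of such sums.\<close>

definition edge_sum :: "'v::finite set set \<Rightarrow> ('v \<Rightarrow> 'v \<Rightarrow> real) \<Rightarrow> real" where
  "edge_sum E f = (\<Sum>u\<in>UNIV. \<Sum>v\<in>UNIV. adj E u v * f u v)"

text \<open>Every path on three vertices is met twice, once from each end.\<close>

definition path2_sum :: "'v::finite set set \<Rightarrow> ('v \<Rightarrow> 'v \<Rightarrow> 'v \<Rightarrow> real) \<Rightarrow> real" where
  "path2_sum E f = (\<Sum>u\<in>UNIV. \<Sum>v\<in>UNIV. \<Sum>w\<in>UNIV. path2 E u w v * f u w v)"

text \<open>The common shape of the entries of the first three powers: \<open>f\<close>,
  \<open>g\<close>, \<open>h\<close> and \<open>c\<close> weight the non-backtracking walks of
  length 0, 1, 2 and 3. A constant suffices for length 3, as these walks first occur in the third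
  power, with weight -1.\<close>

definition walk_entry ::
    "'v::finite set set \<Rightarrow> ('v \<Rightarrow> real) \<Rightarrow> ('v \<Rightarrow> 'v \<Rightarrow> real) \<Rightarrow> ('v \<Rightarrow> 'v \<Rightarrow> 'v \<Rightarrow> real)
      \<Rightarrow> real \<Rightarrow> 'v \<Rightarrow> 'v \<Rightarrow> real" where
  "walk_entry E f g h c u v = of_bool (u = v) * f u + adj E u v * g u v
     + (\<Sum>w\<in>UNIV. path2 E u w v * h u w v) + (\<Sum>x\<in>UNIV. \<Sum>y\<in>UNIV. path3 E u x y v * c)"

lemma simple_graph_no_loop: "simple_graph E \<Longrightarrow> {u} \<notin> E"
  by (auto simp: simple_graph_def)

lemma adj_self: "simple_graph E \<Longrightarrow> adj E u u = 0"
  by (simp add: adj_def simple_graph_no_loop)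

lemma adj_commute: "adj E u v = adj E v u"
  by (simp add: adj_def insert_commute)

lemma adj_idem: "adj E u v * adj E u v = adj E u v"
  by (simp add: adj_def)

lemma sum_adj:
  assumes "simple_graph E"
  shows "(\<Sum>v\<in>UNIV. adj E u v) = real (deg E u)"
proof -
  have "{e \<in> E. u \<in> e} = (\<lambda>v. {u, v}) ` {v. {u, v} \<in> E}"
    using assms by (auto simp: simple_graph_def card_2_iff doubleton_eq_iff image_iff insert_commute)
  moreover have "inj_on (\<lambda>v. {u, v}) {v. {u, v} \<in> E}"
    by (auto simp: inj_on_def doubleton_eq_iff)
  ultimately have "deg E u = card {v. {u, v} \<in> E}"
    by (simp add: deg_def card_image)
  then show ?thesis by (simp add: adj_def of_bool_def sum.If_cases)
qed

lemma laplacian_entry: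
  assumes "simple_graph E"
  shows "laplacian_matrix E $ u $ v = walk_entry E (\<lambda>u. real (deg E u)) (\<lambda>u v. -1) (\<lambda>u w v. 0) 0 u v"
  using simple_graph_no_loop[OF assms]
  by (auto simp: laplacian_matrix_def degree_matrix_def adjacency_matrix_def walk_entry_def adj_def)

lemma laplacian_mult_entry:
  assumes "simple_graph E"
  shows "(laplacian_matrix E ** M) $ u $ v
    = real (deg E u) * M $ u $ v - (\<Sum>x\<in>UNIV. adj E u x * M $ x $ v)"
proof -
  have "laplacian_matrix E $ u $ x * M $ x $ v
     = (if x = u then real (deg E u) * M $ u $ v else 0) - adj E u x * M $ x $ v" for x
    by (simp add: laplacian_entry[OF assms] walk_entry_def algebra_simps)
  then show ?thesis
    by (simp add: matrix_matrix_mult_def sum_subtractf)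
qed

text \<open>After a step from \<open>u\<close> to a neighbour \<open>x\<close>, the entry at
  \<open>(x, v)\<close> either stays at \<open>x = v\<close>, extends to a path \<open>u\<close>,
  \<open>x\<close>, \<open>v\<close>, or turns back to \<open>u = v\<close>; the last case occurs
  once for each neighbour of \<open>u\<close>.\<close>

lemma laplacian2_entry:
  assumes "simple_graph E"
  defines "d \<equiv> \<lambda>u. real (deg E u)"
  shows "(laplacian_matrix E ** laplacian_matrix E) $ u $ v
    = walk_entry E (\<lambda>u. d u ^ 2 + d u) (\<lambda>u v. - (d u + d v)) (\<lambda>u w v. 1) 0 u v"
proof -
  have "adj E u x * laplacian_matrix E $ x $ v
      = (if x = v then adj E u v * d v else 0) - path2 E u x v - of_bool (u = v) * adj E u x" for x
    using adj_idem[of E u x]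
    by (auto simp: laplacian_entry[OF assms(1)] walk_entry_def path2_def d_def adj_commute)
  then have "(\<Sum>x\<in>UNIV. adj E u x * laplacian_matrix E $ x $ v)
      = adj E u v * d v - (\<Sum>x\<in>UNIV. path2 E u x v) - of_bool (u = v) * d u"
    by (simp add: sum_subtractf sum_distrib_left[symmetric] sum_adj[OF assms(1)] d_def)
  then show ?thesis
    by (simp add: laplacian_mult_entry[OF assms(1)] laplacian_entry[OF assms(1)] walk_entry_def
        d_def algebra_simps power2_eq_square)
qed

text \<open>One more multiplication from the left. Steps that turn back land on the diagonal, where
  they bring in the degrees of the neighbours, or on the edges, where they give the correction
  \<open>d u - 1\<close>.\<close>

lemma laplacian3_entry:
  assumes "simple_graph E"
  defines "d \<equiv> \<lambda>u. real (deg E u)"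
  shows "(laplacian_matrix E ** (laplacian_matrix E ** laplacian_matrix E)) $ u $ v
    = walk_entry E (\<lambda>u. d u ^ 3 + 2 * d u ^ 2 + (\<Sum>x\<in>UNIV. adj E u x * d x))
        (\<lambda>u v. - (d u ^ 2 + d u * d v + d v ^ 2 + d u + d v - 1)) (\<lambda>u w v. d u + d w + d v) (-1) u v"
proof -
  let ?L2 = "laplacian_matrix E ** laplacian_matrix E"
  have deg: "(\<Sum>x\<in>UNIV. adj E u x) = d u" for u
    by (simp add: d_def sum_adj[OF assms(1)])
  have path2_split: "adj E u x * (adj E x v * (d x + d v))
      = path2 E u x v * (d x + d v) + of_bool (u = v) * (adj E u x * d x + d u * adj E u x)" for x
    using adj_idem[of E u x] by (auto simp: path2_def adj_commute algebra_simps)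
  \<comment> \<open>Prepending \<open>u\<close> to \<open>x\<close>, \<open>y\<close>,
    \<open>v\<close> backtracks exactly if \<open>y = u\<close>. The walk then collapses to the edge
    from \<open>u\<close> to \<open>v\<close>, and \<open>x\<close> is any neighbour of
    \<open>u\<close> other than \<open>v\<close>.\<close>
  have path3_split: "adj E u x * path2 E x y v
      = path3 E u x y v + (if y = u then adj E u v * adj E u x - (if x = v then adj E u v else 0) else 0)" for x y
    using adj_idem[of E u x] by (auto simp: path2_def path3_def adj_commute algebra_simps)
  have "adj E u x * ?L2 $ x $ v
      = (if x = v then adj E u v * (d v ^ 2 + d v) else 0) - adj E u x * (adj E x v * (d x + d v))
        + (\<Sum>y\<in>UNIV. adj E u x * path2 E x y v)" for x
    by (simp add: laplacian2_entry[OF assms(1)] walk_entry_def d_def algebra_simps sum_distrib_left)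
  then have "(\<Sum>x\<in>UNIV. adj E u x * ?L2 $ x $ v)
     = adj E u v * (d v ^ 2 + d v) - (\<Sum>x\<in>UNIV. adj E u x * (adj E x v * (d x + d v)))
       + (\<Sum>x\<in>UNIV. \<Sum>y\<in>UNIV. adj E u x * path2 E x y v)"
    by (simp add: sum_subtractf sum.distrib)
  also have "(\<Sum>x\<in>UNIV. adj E u x * (adj E x v * (d x + d v)))
     = (\<Sum>x\<in>UNIV. path2 E u x v * (d x + d v))
       + of_bool (u = v) * ((\<Sum>x\<in>UNIV. adj E u x * d x) + d u ^ 2)"
    unfolding path2_split
    by (simp add: sum.distrib sum_distrib_left[symmetric] deg power2_eq_square)
  also have "(\<Sum>x\<in>UNIV. \<Sum>y\<in>UNIV. adj E u x * path2 E x y v)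
     = (\<Sum>x\<in>UNIV. \<Sum>y\<in>UNIV. path3 E u x y v) + adj E u v * (d u - 1)"
    unfolding path3_split
    by (simp add: sum.distrib sum_subtractf sum_distrib_left[symmetric] deg) (simp add: right_diff_distrib)
  finally show ?thesis
    by (simp add: laplacian_mult_entry[OF assms(1), of ?L2] laplacian2_entry[OF assms(1)]
        walk_entry_def d_def algebra_simps power2_eq_square power3_eq_cube sum.distrib sum_distrib_left sum_negf)
qed

section \<open>Uniqueness of short non-backtracking walks in a forest\<close>

lemma forest_no_cycle:
  assumes "forest E" "length vs \<ge> 3" "distinct vs"
    "\<forall>i<length vs. {vs ! i, vs ! ((i + 1) mod length vs)} \<in> E"
  shows False
  using assms unfolding forest_def graph_cycle_def by blast

lemma forest_edge_distinct: "forest E \<Longrightarrow> {u, v} \<in> E \<Longrightarrow> u \<noteq> v"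
  using simple_graph_no_loop by (force simp: forest_def)

lemma forest_no_triangle:
  assumes "forest E" "{x, y} \<in> E" "{y, z} \<in> E" "{z, x} \<in> E"
  shows False
proof (rule forest_no_cycle[OF assms(1), of "[x, y, z]"])
  have "simple_graph E" using assms(1) by (simp add: forest_def)
  then show "distinct [x, y, z]"
    using assms(2-4) simple_graph_no_loop by fastforce
qed (use assms in \<open>auto simp: less_Suc_eq\<close>)

text \<open>Adjacent vertices are distinct, so a closed walk of length four fails to be a cycle only
  if two opposite vertices coincide.\<close>

lemma forest_no_4_cycle:
  assumes "forest E" "{x, y} \<in> E" "{y, z} \<in> E" "{z, w} \<in> E" "{w, x} \<in> E"
  shows "x = z \<or> y = w"
proof (rule ccontr)
  assume "\<not> (x = z \<or> y = w)"
  moreover have "simple_graph E" using assms(1) by (simp add: forest_def)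
  ultimately have "distinct [x, y, z, w]"
    using assms(2-) simple_graph_no_loop by fastforce
  then show False
    by (rule forest_no_cycle[OF assms(1), rotated]) (use assms in \<open>auto simp: less_Suc_eq\<close>)
qed

text \<open>If two non-adjacent vertices of the closed walk coincided, a triangle would remain;
  hence all five are distinct and form a cycle.\<close>

lemma forest_no_5_cycle:
  assumes "forest E" "{x, y} \<in> E" "{y, z} \<in> E" "{z, w} \<in> E" "{w, t} \<in> E" "{t, x} \<in> E"
  shows False
proof (rule forest_no_cycle[OF assms(1), of "[x, y, z, w, t]"])
  note loop = forest_edge_distinct[OF assms(1)]
  show "distinct [x, y, z, w, t]"
    using assms(2-) loop forest_no_triangle[OF assms(1)] by (auto simp: insert_commute)
qed (use assms in \<open>auto simp: less_Suc_eq\<close>)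

text \<open>Two non-backtracking walks of length three with common ends form a closed walk of length
  six. Any coincidence among its vertices leaves a triangle or a closed walk of length four, so the
  walks agree or there is a 6-cycle.\<close>

lemma forest_6_cycle:
  assumes "forest E" "{u, x} \<in> E" "{x, y} \<in> E" "{y, v} \<in> E" "{u, x'} \<in> E" "{x', y'} \<in> E" "{y', v} \<in> E"
    "u \<noteq> y" "x \<noteq> v" "u \<noteq> y'" "x' \<noteq> v"
  shows "x = x' \<and> y = y'"
proof -
  note loop = forest_edge_distinct[OF assms(1)]
  have uv: "u \<noteq> v" using forest_no_triangle[OF assms(1)] assms(2-4) by blast
  have xy': "x \<noteq> y'" using forest_no_triangle[OF assms(1), of x y v] assms by (auto simp: insert_commute)
  have yx': "x' \<noteq> y" using forest_no_triangle[OF assms(1), of x' y' v] assms by (auto simp: insert_commute)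
  have *: "x = x' \<longleftrightarrow> y = y'"
    using forest_no_4_cycle[OF assms(1), of x y v y'] forest_no_4_cycle[OF assms(1), of u x y x'] assms
    by (auto simp: insert_commute)
  show ?thesis
  proof (rule ccontr)
    assume "\<not> (x = x' \<and> y = y')"
    with * have "distinct [u, x, y, v, y', x']"
      using assms loop uv xy' yx' by (auto simp: insert_commute)
    then show False
      by (rule forest_no_cycle[OF assms(1), rotated])
         (use assms in \<open>auto simp: less_Suc_eq insert_commute\<close>)
  qed
qed

lemma sum_single:
  assumes "finite S" "w \<in> S" "\<And>x. x \<in> S \<Longrightarrow> x \<noteq> w \<Longrightarrow> f x = 0"
  shows "sum f S = (f w :: real)"
  using assms by (subst sum.remove[of S w]) auto

text \<open>
  In a forest two vertices are joined by at most one non-backtracking walk of length at most three,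
  so for fixed \<open>u\<close> and \<open>v\<close> at most one of all the summands of \<open>walk_entry\<close> is nonzero.
\<close>

lemma walk_entry_mult:
  assumes "forest E"
  shows "walk_entry E f g h c u v * walk_entry E f' g' h' c' u v
    = walk_entry E (\<lambda>u. f u * f' u) (\<lambda>u v. g u v * g' u v) (\<lambda>u w v. h u w v * h' u w v) (c * c') u v"
proof -
  have simple: "simple_graph E" using assms by (simp add: forest_def)
  \<comment> \<open>Two walks from \<open>u\<close> to \<open>v\<close> close up to a walk whose
    length is the sum of theirs. Lengths 3 to 6 arise here and in \<open>path3D\<close>, and each is
    covered by one of the cycle lemmas.\<close>
  have path2D: "u \<noteq> v \<and> {u, v} \<notin> E \<and> path2 E u w v = 1 \<and> (\<forall>w'. w' \<noteq> w \<longrightarrow> path2 E u w' v = 0)"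
    if "path2 E u w v \<noteq> 0" for w
    using that forest_no_triangle[OF assms, of u w v] forest_no_4_cycle[OF assms, of u w v]
    by (auto simp: path2_def adj_def insert_commute split: if_splits)
  have path3D: "u \<noteq> v \<and> {u, v} \<notin> E \<and> (\<forall>w. path2 E u w v = 0) \<and> path3 E u x y v = 1
      \<and> (\<forall>z. z \<noteq> (x, y) \<longrightarrow> path3 E u (fst z) (snd z) v = 0)"
    if "path3 E u x y v \<noteq> 0" for x y
    using that forest_no_triangle[OF assms, of u x y] forest_no_4_cycle[OF assms, of u x y v]
      forest_no_5_cycle[OF assms, of u x y v] forest_6_cycle[OF assms, of u x y v]
    by (auto simp: path2_def path3_def adj_def insert_commute split: if_splits)
  consider (p3) x y where "path3 E u x y v \<noteq> 0"
    | (p2) w where "path2 E u w v \<noteq> 0" "\<And>x y. path3 E u x y v = 0"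
    | (none) "\<And>w. path2 E u w v = 0" "\<And>x y. path3 E u x y v = 0"
    by blast
  then show ?thesis
  proof cases
    case p3
    note D = path3D[OF p3]
    have D': "path3 E u x y v = 1" "z \<noteq> (x, y) \<Longrightarrow> path3 E u (fst z) (snd z) v = 0" for z
      using D by blast+
    have sum3: "(\<Sum>x'\<in>UNIV. \<Sum>y'\<in>UNIV. path3 E u x' y' v * k) = k" for k
      unfolding sum.cartesian_product
      by (subst sum_single[of _ "(x, y)"]) (simp_all add: case_prod_beta D')
    show ?thesis
      unfolding walk_entry_def sum3 using D by (simp add: adj_def)
  next
    case (p2 w)
    note D = path2D[OF p2(1)]
    have sum2: "(\<Sum>w\<in>UNIV. path2 E u w v * k w) = k w" for k
      by (subst sum_single[of _ w]) (use D in auto)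
    show ?thesis
      unfolding walk_entry_def sum2 using D p2(2) by (simp add: adj_def)
  next
    case none
    then show ?thesis
      using simple_graph_no_loop[OF simple] by (auto simp: walk_entry_def adj_def)
  qed
qed

subsection \<open>Sums over edges and paths\<close>

lemma edge_sum_add: "edge_sum E (\<lambda>u v. f u v + g u v) = edge_sum E f + edge_sum E g"
  by (simp add: edge_sum_def distrib_left sum.distrib)

lemma edge_sum_diff: "edge_sum E (\<lambda>u v. f u v - g u v) = edge_sum E f - edge_sum E g"
  by (simp add: edge_sum_def right_diff_distrib sum_subtractf)

lemma edge_sum_cmult: "edge_sum E (\<lambda>u v. c * f u v) = c * edge_sum E f"
  by (simp add: edge_sum_def sum_distrib_left mult.left_commute)

lemma edge_sum_commute: "edge_sum E (\<lambda>u v. f v u) = edge_sum E f"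
  unfolding edge_sum_def by (subst sum.swap) (simp add: adj_commute)

lemma edge_sum_left:
  "simple_graph E \<Longrightarrow> edge_sum E (\<lambda>u v. f u) = (\<Sum>u\<in>UNIV. f u * real (deg E u))"
  by (simp add: edge_sum_def sum_adj mult.commute flip: sum_distrib_left)

lemma path2_sum_add: "path2_sum E (\<lambda>u w v. f u w v + g u w v) = path2_sum E f + path2_sum E g"
  by (simp add: path2_sum_def distrib_left sum.distrib)

lemma path2_sum_cmult: "path2_sum E (\<lambda>u w v. c * f u w v) = c * path2_sum E f"
  by (simp add: path2_sum_def sum_distrib_left mult.left_commute)

lemma path2_sum_commute: "path2_sum E (\<lambda>u w v. f v w u) = path2_sum E f"
proof -
  have "path2 E u w v = path2 E v w u" for u w v
    by (simp add: path2_def adj_commute mult.commute eq_commute)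
  then show ?thesis
    unfolding path2_sum_def by (subst sum.swap) simp
qed

text \<open>An edge from \<open>u\<close> to \<open>w\<close> extends beyond \<open>w\<close> to
  every neighbour of \<open>w\<close> except \<open>u\<close>.\<close>

lemma path2_sum_left:
  assumes "simple_graph E"
  shows "path2_sum E (\<lambda>u w v. f u w) = edge_sum E (\<lambda>u w. f u w * (real (deg E w) - 1))"
proof -
  have "(\<Sum>v\<in>UNIV. path2 E u w v * f u w) = adj E u w * (f u w * (real (deg E w) - 1))" for u w
  proof -
    have "path2 E u w v * f u w = (adj E u w * f u w) * adj E w v - (if v = u then adj E u w * f u w else 0)" for v
      using adj_idem[of E u w] by (auto simp: path2_def adj_commute algebra_simps)
    then show ?thesis
      by (simp add: sum_subtractf sum_adj[OF assms] flip: sum_distrib_left) (simp add: algebra_simps)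
  qed
  then show ?thesis
    unfolding path2_sum_def edge_sum_def by (subst sum.swap[of _ UNIV UNIV]) simp
qed

text \<open>Once the middle edge is fixed, the two end vertices are chosen independently.\<close>

lemma path3_sum:
  fixes E :: "'v::finite set set"
  assumes "simple_graph E"
  shows "(\<Sum>u\<in>UNIV. \<Sum>v\<in>UNIV. \<Sum>x\<in>UNIV. \<Sum>y\<in>UNIV. path3 E u x y v)
    = edge_sum E (\<lambda>x y. (real (deg E x) - 1) * (real (deg E y) - 1))"
proof -
  have d1: "(\<Sum>u\<in>UNIV. adj E x y * (adj E u x * of_bool (u \<noteq> y))) = adj E x y * (real (deg E x) - 1)" for x y
  proof -
    have "adj E x y * (adj E u x * of_bool (u \<noteq> y)) = adj E x y * adj E x u - (if u = y then adj E x y else 0)" for u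
      using adj_idem[of E x y] by (auto simp: adj_commute)
    then show ?thesis
      by (simp add: sum_subtractf sum_adj[OF assms] flip: sum_distrib_left) (simp add: right_diff_distrib)
  qed
  have "(\<Sum>u\<in>UNIV. \<Sum>v\<in>UNIV. path3 E u x y v) = adj E x y * ((real (deg E x) - 1) * (real (deg E y) - 1))" for x y
  proof -
    \<comment> \<open>The idempotent factor \<open>adj E x y\<close> is duplicated so that
      \<open>d1\<close> applies to both ends.\<close>
    have "(\<Sum>u\<in>UNIV. \<Sum>v\<in>UNIV. path3 E u x y v)
       = (\<Sum>u\<in>UNIV. adj E x y * (adj E u x * of_bool (u \<noteq> y))) * (\<Sum>v\<in>UNIV. adj E y x * (adj E v y * of_bool (v \<noteq> x)))"
      unfolding sum_product
      using adj_idem[of E x y] by (intro sum.cong refl) (auto simp: path3_def adj_commute)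
    also have "\<dots> = adj E x y * ((real (deg E x) - 1) * (real (deg E y) - 1))"
      unfolding d1 using adj_idem[of E x y] by (auto simp: adj_commute)
    finally show ?thesis .
  qed
  moreover have "(\<Sum>u\<in>UNIV. \<Sum>v\<in>UNIV. \<Sum>x\<in>UNIV. \<Sum>y\<in>UNIV. path3 E u x y v)
     = (\<Sum>x\<in>UNIV. \<Sum>y\<in>UNIV. \<Sum>u\<in>UNIV. \<Sum>v\<in>UNIV. path3 E u x y v)"
  proof -
    have pair: "(\<Sum>u\<in>UNIV. \<Sum>v\<in>UNIV. H u v) = (\<Sum>p\<in>UNIV. H (fst p) (snd p))"
      for H :: "'v \<Rightarrow> 'v \<Rightarrow> real"
      by (simp add: sum.cartesian_product case_prod_beta)
    show ?thesis unfolding pair by (rule sum.swap)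
  qed
  ultimately show ?thesis by (simp add: edge_sum_def)
qed

text \<open>Together with \<open>walk_entry_mult\<close> this evaluates the sum of entrywise
  products that equals a trace.\<close>

lemma sum_walk_entry:
  assumes "simple_graph E"
  shows "(\<Sum>u\<in>UNIV. \<Sum>v\<in>UNIV. walk_entry E f g h c u v)
    = (\<Sum>u\<in>UNIV. f u) + edge_sum E g + path2_sum E h
      + c * edge_sum E (\<lambda>x y. (real (deg E x) - 1) * (real (deg E y) - 1))"
proof -
  have "of_bool (u = v) * f u = (if v = u then f u else 0)" for u v by auto
  then show ?thesis
    unfolding walk_entry_def path3_sum[OF assms, symmetric]
    by (simp add: sum.distrib edge_sum_def path2_sum_def mult.commute[of _ c] flip: sum_distrib_left)
qed

text \<open>An ordered pair of adjacent vertices lies in exactly one edge. The right-hand side has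
  the shape of \<open>alpha\<close>.\<close>

lemma edge_sum_eq:
  assumes "simple_graph E"
  shows "edge_sum E f = (\<Sum>e\<in>E. \<Sum>u\<in>e. \<Sum>v\<in>e - {u}. f u v)"
proof -
  have "(\<Sum>e\<in>E. \<Sum>u\<in>e. \<Sum>v\<in>e - {u}. f u v)
    = (\<Sum>e\<in>E. \<Sum>u\<in>UNIV. \<Sum>v\<in>UNIV. of_bool (u \<in> e \<and> v \<in> e - {u}) * f u v)"
  proof (rule sum.cong[OF refl])
    fix e
    have "(\<Sum>v\<in>UNIV. of_bool (u \<in> e \<and> v \<in> e - {u}) * f u v) = (if u \<in> e then \<Sum>v\<in>e - {u}. f u v else 0)" for u
      by (auto intro!: sum.mono_neutral_cong_right)
    then show "(\<Sum>u\<in>e. \<Sum>v\<in>e - {u}. f u v) = (\<Sum>u\<in>UNIV. \<Sum>v\<in>UNIV. of_bool (u \<in> e \<and> v \<in> e - {u}) * f u v)"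
      by (simp add: sum.If_cases)
  qed
  also have "\<dots> = (\<Sum>u\<in>UNIV. \<Sum>v\<in>UNIV. (\<Sum>e\<in>E. of_bool (u \<in> e \<and> v \<in> e - {u})) * f u v)"
    by (simp only: sum_distrib_right sum.swap[of _ UNIV E])
  also have "\<dots> = edge_sum E f"
  proof -
    have "(\<Sum>e\<in>E. of_bool (u \<in> e \<and> v \<in> e - {u})) = adj E u v" for u v
    proof -
      have "(\<Sum>e\<in>E. of_bool (u \<in> e \<and> v \<in> e - {u})) = (\<Sum>e\<in>E. if e = {u, v} then 1 else (0::real))"
      proof (rule sum.cong[OF refl])
        fix e assume "e \<in> E"
        then have "card e = 2" using assms by (simp add: simple_graph_def)
        then show "of_bool (u \<in> e \<and> v \<in> e - {u}) = (if e = {u, v} then 1 else (0::real))"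
          by (auto simp: card_2_iff)
      qed
      then show ?thesis by (simp add: adj_def)
    qed
    then show ?thesis by (simp add: edge_sum_def)
  qed
  finally show ?thesis by simp
qed

lemma edge_sum_prod:
  assumes "simple_graph E"
  shows "edge_sum E (\<lambda>u v. g u * g v) = 2 * (\<Sum>e\<in>E. \<Prod>v\<in>e. g v)"
  unfolding edge_sum_eq[OF assms] sum_distrib_left
proof (rule sum.cong[OF refl])
  fix e assume "e \<in> E"
  then have "card e = 2" using assms by (simp add: simple_graph_def)
  then obtain a b where "e = {a, b}" "a \<noteq> b" by (auto simp: card_2_iff)
  then show "(\<Sum>u\<in>e. \<Sum>v\<in>e - {u}. g u * g v) = 2 * (\<Prod>v\<in>e. g v)"
    by (simp add: insert_Diff_if)
qed

lemma edge_sum_1: "simple_graph E \<Longrightarrow> edge_sum E (\<lambda>u v. 1) = 2 * real (card E)"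
  using edge_sum_prod[of E "\<lambda>_. 1"] by simp

text \<open>For a fixed middle vertex \<open>w\<close> the pairs of ends are the edges of an
  auxiliary simple graph \<open>F w\<close>, so \<open>edge_sum_prod\<close> applies; these edge
  sets together make up \<open>P3_subgraphs E\<close>.\<close>

lemma path2_sum_prod:
  fixes E :: "'v::finite set set"
  shows "path2_sum E (\<lambda>u w v. real (deg E u) * real (deg E v)) = 2 * Theta2 E"
proof -
  define F where "F w = {{u, v} | u v. u \<noteq> v \<and> {u, w} \<in> E \<and> {w, v} \<in> E}" for w
  have simple: "simple_graph (F w)" for w
    by (auto simp: simple_graph_def F_def)
  have adjF: "adj (F w) u v = path2 E u w v" for u v w
    by (auto simp: adj_def F_def path2_def doubleton_eq_iff insert_commute)
  have "path2_sum E (\<lambda>u w v. real (deg E u) * real (deg E v))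
      = (\<Sum>w\<in>UNIV. edge_sum (F w) (\<lambda>u v. real (deg E u) * real (deg E v)))"
    unfolding edge_sum_def path2_sum_def adjF
    by (subst sum.swap, subst (2) sum.swap) (rule refl)
  also have "\<dots> = 2 * (\<Sum>w\<in>UNIV. \<Sum>S\<in>F w. \<Prod>u\<in>S. real (deg E u))"
    by (simp add: edge_sum_prod[OF simple] sum_distrib_left)
  also have "(\<Sum>w\<in>UNIV. \<Sum>S\<in>F w. \<Prod>u\<in>S. real (deg E u)) = Theta2 E"
  proof -
    have "P3_subgraphs E = Sigma UNIV F"
      by (auto simp: P3_subgraphs_def F_def) metis
    then show ?thesis by (simp add: Theta2_def sum.Sigma)
  qed
  finally show ?thesis .
qed

section \<open>Traces of the first six powers of the Laplacian matrix\<close>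

text \<open>The exponents 2 to 6 are split as 1+1, 1+2, 2+2, 2+3 and 3+3, and the entrywise products
  are summed as walk entries. Exponent 1 is read off the diagonal.\<close>

lemma laplacian_traces:
  assumes "forest E"
  defines "m \<equiv> real (card E)" and "L \<equiv> laplacian_matrix E"
  shows "trace (mat_power L 1) = 2 * m"
    and "trace (mat_power L 2) = M1 E 2 + 2 * m"
    and "trace (mat_power L 3) = M1 E 3 + 3 * M1 E 2"
    and "trace (mat_power L 4) = M1 E 4 + 4 * M1 E 3 + 2 * M1 E 2 + 4 * M2 E 1 - 2 * m"
    and "trace (mat_power L 5) = M1 E 5 + 5 * M1 E 4 + 5 * M1 E 3 - 5 * M1 E 2 + 5 * alpha E 1 2 + 10 * M2 E 1"
    and "trace (mat_power L 6) = M1 E 6 + 6 * M1 E 5 + 9 * M1 E 4 - 4 * M1 E 3 - 6 * M1 E 2 + 4 * m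
       + 6 * alpha E 1 3 + 18 * alpha E 1 2 + 6 * M2 E 2 - 6 * M2 E 1 + 6 * Theta2 E"
proof -
  have simple: "simple_graph E" using assms(1) by (simp add: forest_def)
  define d where "d u = real (deg E u)" for u
  define S where "S u = (\<Sum>x\<in>UNIV. adj E u x * d x)" for u
  \<comment> \<open>At isolated vertices \<open>powr\<close> and the ordinary power agree, both
    being 0, because the exponents are positive.\<close>
  have M: "M1 E 2 = (\<Sum>u\<in>UNIV. d u ^ 2)" "M1 E 3 = (\<Sum>u\<in>UNIV. d u ^ 3)" "M1 E 4 = (\<Sum>u\<in>UNIV. d u ^ 4)"
    "M1 E 5 = (\<Sum>u\<in>UNIV. d u ^ 5)" "M1 E 6 = (\<Sum>u\<in>UNIV. d u ^ 6)"
    by (simp_all add: M1_def d_def)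
  have left: "edge_sum E (\<lambda>u v. f u) = (\<Sum>u\<in>UNIV. f u * d u)" for f
    by (simp add: edge_sum_left[OF simple] d_def)
  have right: "edge_sum E (\<lambda>u v. f v) = (\<Sum>u\<in>UNIV. f u * d u)" for f
    using edge_sum_commute[of E "\<lambda>u v. f u"] left[of f] by simp
  have e0: "edge_sum E (\<lambda>u v. 1) = 2 * m"
    using edge_sum_1[OF simple] by (simp add: m_def)
  have sd: "(\<Sum>u\<in>UNIV. d u) = 2 * m"
    using left[of "\<lambda>_. 1"] e0 by simp
  \<comment> \<open>Summing over the other end of the edge contributes a degree, which raises the
    exponent by one.\<close>
  have e1: "edge_sum E (\<lambda>u v. d u) = M1 E 2" "edge_sum E (\<lambda>u v. d v) = M1 E 2"
    "edge_sum E (\<lambda>u v. d u ^ 2) = M1 E 3" "edge_sum E (\<lambda>u v. d v ^ 2) = M1 E 3"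
    "edge_sum E (\<lambda>u v. d u ^ 3) = M1 E 4" "edge_sum E (\<lambda>u v. d v ^ 3) = M1 E 4"
    "edge_sum E (\<lambda>u v. d u ^ 4) = M1 E 5" "edge_sum E (\<lambda>u v. d v ^ 4) = M1 E 5"
    unfolding left right M by (simp_all add: eval_nat_numeral mult_ac)
  have e11: "edge_sum E (\<lambda>u v. d u * d v) = 2 * M2 E 1"
    unfolding edge_sum_prod[OF simple] by (simp add: M2_def d_def prod_nonneg)
  have e22: "edge_sum E (\<lambda>u v. d u ^ 2 * d v ^ 2) = 2 * M2 E 2"
    unfolding edge_sum_prod[OF simple] by (simp add: M2_def d_def prod_nonneg prod_power_distrib)
  have e12: "edge_sum E (\<lambda>u v. d u * d v ^ 2) = alpha E 1 2" "edge_sum E (\<lambda>u v. d u ^ 2 * d v) = alpha E 1 2"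
  proof -
    show *: "edge_sum E (\<lambda>u v. d u * d v ^ 2) = alpha E 1 2"
      unfolding edge_sum_eq[OF simple] alpha_def by (simp add: d_def)
    show "edge_sum E (\<lambda>u v. d u ^ 2 * d v) = alpha E 1 2"
      using edge_sum_commute[of E "\<lambda>u v. d u * d v ^ 2"] * by (simp add: mult.commute)
  qed
  have e13: "edge_sum E (\<lambda>u v. d u * d v ^ 3) = alpha E 1 3" "edge_sum E (\<lambda>u v. d u ^ 3 * d v) = alpha E 1 3"
  proof -
    show *: "edge_sum E (\<lambda>u v. d u * d v ^ 3) = alpha E 1 3"
      unfolding edge_sum_eq[OF simple] alpha_def by (simp add: d_def)
    show "edge_sum E (\<lambda>u v. d u ^ 3 * d v) = alpha E 1 3"
      using edge_sum_commute[of E "\<lambda>u v. d u * d v ^ 3"] * by (simp add: mult.commute)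
  qed
  note es = edge_sum_add edge_sum_diff edge_sum_cmult e0 e1 e11 e22 e12 e13
  have p_left: "path2_sum E (\<lambda>u w v. f u w) = edge_sum E (\<lambda>u w. f u w * (d w - 1))" for f
    by (simp add: path2_sum_left[OF simple] d_def)
  have p_right: "path2_sum E (\<lambda>u w v. f v w) = edge_sum E (\<lambda>u w. f u w * (d w - 1))" for f
    using path2_sum_commute[of E "\<lambda>u w v. f u w"] p_left[of f] by simp
  have p0: "path2_sum E (\<lambda>u w v. 1) = M1 E 2 - 2 * m"
    by (simp add: p_left[of "\<lambda>u w. 1"] es)
  have pz: "path2_sum E (\<lambda>u w v. d w) = M1 E 3 - M1 E 2"
    by (simp add: p_left[of "\<lambda>u w. d w"] right_diff_distrib es flip: power2_eq_square)
  have pzz: "path2_sum E (\<lambda>u w v. d w ^ 2) = M1 E 4 - M1 E 3"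
  proof -
    have "d w ^ 2 * (d w - 1) = d w ^ 3 - d w ^ 2" for w by algebra
    then show ?thesis by (simp add: p_left[of "\<lambda>u w. d w ^ 2"] es)
  qed
  have px: "path2_sum E (\<lambda>u w v. d u) = 2 * M2 E 1 - M1 E 2" "path2_sum E (\<lambda>u w v. d v) = 2 * M2 E 1 - M1 E 2"
    by (simp_all add: p_left[of "\<lambda>u w. d u"] p_right[of "\<lambda>u w. d u"] right_diff_distrib es)
  have pxx: "path2_sum E (\<lambda>u w v. d u ^ 2) = alpha E 1 2 - M1 E 3" "path2_sum E (\<lambda>u w v. d v ^ 2) = alpha E 1 2 - M1 E 3"
    by (simp_all add: p_left[of "\<lambda>u w. d u ^ 2"] p_right[of "\<lambda>u w. d u ^ 2"] right_diff_distrib es)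
  have pxz: "path2_sum E (\<lambda>u w v. d u * d w) = alpha E 1 2 - 2 * M2 E 1" "path2_sum E (\<lambda>u w v. d v * d w) = alpha E 1 2 - 2 * M2 E 1"
  proof -
    have "d u * d w * (d w - 1) = d u * d w ^ 2 - d u * d w" for u w by algebra
    then show "path2_sum E (\<lambda>u w v. d u * d w) = alpha E 1 2 - 2 * M2 E 1" "path2_sum E (\<lambda>u w v. d v * d w) = alpha E 1 2 - 2 * M2 E 1"
      by (simp_all add: p_left[of "\<lambda>u w. d u * d w"] p_right[of "\<lambda>u w. d u * d w"] es)
  qed
  have pxy: "path2_sum E (\<lambda>u w v. d u * d v) = 2 * Theta2 E"
    by (simp add: path2_sum_prod d_def)
  note ps = path2_sum_add path2_sum_cmult p0 pz pzz px pxx pxz pxy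
  have dS: "(\<Sum>u\<in>UNIV. f u * S u) = edge_sum E (\<lambda>u v. f u * d v)" for f
    by (simp add: S_def edge_sum_def sum_distrib_left mult.left_commute)
  \<comment> \<open>In the square of a neighbour sum, two different neighbours of \<open>w\<close>
    are the ends of a path with middle vertex \<open>w\<close>; equal neighbours give squared
    degrees summed over directed edges.\<close>
  have SS: "(\<Sum>u\<in>UNIV. S u ^ 2) = 2 * Theta2 E + M1 E 3"
  proof -
    have "S w ^ 2 = (\<Sum>u\<in>UNIV. \<Sum>v\<in>UNIV. path2 E u w v * (d u * d v)) + (\<Sum>v\<in>UNIV. adj E w v * d v ^ 2)" for w
    proof -
      have "adj E w u * d u * (adj E w v * d v)
          = path2 E u w v * (d u * d v) + (if v = u then adj E w u * d u ^ 2 else 0)" for u v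
        using adj_idem[of E w u] by (auto simp: path2_def adj_commute power2_eq_square)
      then show ?thesis
        by (simp add: S_def power2_eq_square sum_product sum.distrib)
    qed
    then have "(\<Sum>u\<in>UNIV. S u ^ 2) = (\<Sum>w\<in>UNIV. \<Sum>u\<in>UNIV. \<Sum>v\<in>UNIV. path2 E u w v * (d u * d v)) + edge_sum E (\<lambda>u v. d v ^ 2)"
      by (simp add: sum.distrib edge_sum_def)
    also have "(\<Sum>w\<in>UNIV. \<Sum>u\<in>UNIV. \<Sum>v\<in>UNIV. path2 E u w v * (d u * d v)) = path2_sum E (\<lambda>u w v. d u * d v)"
      unfolding path2_sum_def by (subst sum.swap, subst (2) sum.swap) (rule refl)
    finally show ?thesis by (simp add: es ps)
  qed
  have L1: "mat_power L 1 $ u $ v = walk_entry E d (\<lambda>u v. -1) (\<lambda>u w v. 0) 0 u v" for u v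
    by (simp add: mat_power_def L_def laplacian_entry[OF simple] d_def[abs_def])
  have L2: "mat_power L 2 $ u $ v = walk_entry E (\<lambda>u. d u ^ 2 + d u) (\<lambda>u v. - (d u + d v)) (\<lambda>u w v. 1) 0 u v" for u v
    using laplacian2_entry[OF simple] by (simp add: mat_power_def L_def d_def numeral_2_eq_2)
  have L3: "mat_power L 3 $ u $ v = walk_entry E (\<lambda>u. d u ^ 3 + 2 * d u ^ 2 + S u)
        (\<lambda>u v. - (d u ^ 2 + d u * d v + d v ^ 2 + d u + d v - 1)) (\<lambda>u w v. d u + d w + d v) (-1) u v" for u v
    using laplacian3_entry[OF simple] by (simp add: mat_power_def L_def d_def S_def numeral_3_eq_3)
  have trans: "transpose L = L"
    by (auto simp: L_def laplacian_matrix_def degree_matrix_def adjacency_matrix_def transpose_def vec_eq_iff insert_commute)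
  note tr = trace_symmetric_mat_power[OF trans]
  \<comment> \<open>The weights of the products are expanded into monomials with known sums:
    \<open>c1\<close> to \<open>c3\<close> for edges, \<open>q1\<close> for walks of length 2,
    \<open>v0\<close> to \<open>v4\<close> for vertices. The number of walks of length 3 is
    \<open>c4\<close>.\<close>
  have c1: "edge_sum E (\<lambda>u v. (d u + d v) * (d u + d v)) = 2 * M1 E 3 + 4 * M2 E 1"
  proof -
    have "(d u + d v) * (d u + d v) = d u ^ 2 + 2 * (d u * d v) + d v ^ 2" for u v by algebra
    then show ?thesis by (simp add: es)
  qed
  have c2: "edge_sum E (\<lambda>u v. (d u + d v) * (d u ^ 2 + d u * d v + d v ^ 2 + d u + d v - 1))
     = 2 * M1 E 4 + 4 * alpha E 1 2 + 2 * M1 E 3 + 4 * M2 E 1 - 2 * M1 E 2"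
  proof -
    have "(d u + d v) * (d u ^ 2 + d u * d v + d v ^ 2 + d u + d v - 1)
      = d u ^ 3 + 2 * (d u ^ 2 * d v) + 2 * (d u * d v ^ 2) + d v ^ 3 + d u ^ 2 + 2 * (d u * d v) + d v ^ 2 - d u - d v" for u v
      by algebra
    then show ?thesis by (simp add: es)
  qed
  have c3: "edge_sum E (\<lambda>u v. (d u ^ 2 + d u * d v + d v ^ 2 + d u + d v - 1) * (d u ^ 2 + d u * d v + d v ^ 2 + d u + d v - 1))
     = 2 * M1 E 5 + 4 * alpha E 1 3 + 6 * M2 E 2 + 4 * M1 E 4 + 8 * alpha E 1 2 - 2 * M1 E 3 - 4 * M1 E 2 + 2 * m"
  proof -
    have "(d u ^ 2 + d u * d v + d v ^ 2 + d u + d v - 1) * (d u ^ 2 + d u * d v + d v ^ 2 + d u + d v - 1)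
      = d u ^ 4 + d v ^ 4 + 2 * (d u ^ 3 * d v) + 2 * (d u * d v ^ 3) + 3 * (d u ^ 2 * d v ^ 2) + 2 * d u ^ 3 + 2 * d v ^ 3
        + 4 * (d u ^ 2 * d v) + 4 * (d u * d v ^ 2) - d u ^ 2 - d v ^ 2 - 2 * d u - 2 * d v + 1" for u v
      by algebra
    then show ?thesis by (simp add: es)
  qed
  have c4: "edge_sum E (\<lambda>u v. (d u - 1) * (d v - 1)) = 2 * M2 E 1 - 2 * M1 E 2 + 2 * m"
  proof -
    have "(d u - 1) * (d v - 1) = d u * d v - d u - d v + 1" for u v by algebra
    then show ?thesis by (simp add: es)
  qed
  have q1: "path2_sum E (\<lambda>u w v. (d u + d w + d v) * (d u + d w + d v))
     = 4 * Theta2 E + 6 * alpha E 1 2 - 8 * M2 E 1 + M1 E 4 - 3 * M1 E 3"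
  proof -
    have "(d u + d w + d v) * (d u + d w + d v)
      = d u ^ 2 + d w ^ 2 + d v ^ 2 + 2 * (d u * d v) + 2 * (d u * d w) + 2 * (d v * d w)" for u v w by algebra
    then show ?thesis by (simp add: ps)
  qed
  have v1: "(\<Sum>u\<in>UNIV. d u * (d u ^ 2 + d u)) = M1 E 3 + M1 E 2"
    by (simp add: M distrib_left sum.distrib power2_eq_square power3_eq_cube mult_ac)
  have v2: "(\<Sum>u\<in>UNIV. (d u ^ 2 + d u) * (d u ^ 2 + d u)) = M1 E 4 + 2 * M1 E 3 + M1 E 2"
  proof -
    have "(d u ^ 2 + d u) * (d u ^ 2 + d u) = d u ^ 4 + 2 * d u ^ 3 + d u ^ 2" for u by algebra
    then show ?thesis by (simp add: M sum.distrib sum_distrib_left)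
  qed
  have v3: "(\<Sum>u\<in>UNIV. (d u ^ 2 + d u) * (d u ^ 3 + 2 * d u ^ 2 + S u))
     = M1 E 5 + 3 * M1 E 4 + 2 * M1 E 3 + alpha E 1 2 + 2 * M2 E 1"
  proof -
    have "(d u ^ 2 + d u) * (d u ^ 3 + 2 * d u ^ 2 + S u)
       = d u ^ 5 + 3 * d u ^ 4 + 2 * d u ^ 3 + d u ^ 2 * S u + d u * S u" for u by algebra
    then show ?thesis by (simp add: M sum.distrib sum_distrib_left dS es)
  qed
  have v4: "(\<Sum>u\<in>UNIV. (d u ^ 3 + 2 * d u ^ 2 + S u) * (d u ^ 3 + 2 * d u ^ 2 + S u))
     = M1 E 6 + 4 * M1 E 5 + 4 * M1 E 4 + 2 * alpha E 1 3 + 4 * alpha E 1 2 + 2 * Theta2 E + M1 E 3"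
  proof -
    have "(d u ^ 3 + 2 * d u ^ 2 + S u) * (d u ^ 3 + 2 * d u ^ 2 + S u)
       = d u ^ 6 + 4 * d u ^ 5 + 4 * d u ^ 4 + 2 * (d u ^ 3 * S u) + 4 * (d u ^ 2 * S u) + S u ^ 2" for u by algebra
    then show ?thesis by (simp add: M(3-5) sum.distrib dS es SS flip: sum_distrib_left)
  qed
  have v0: "(\<Sum>u\<in>UNIV. d u * d u) = M1 E 2"
    by (simp add: M power2_eq_square)
  have path_0: "path2_sum E (\<lambda>u w v. 0) = 0"
    by (simp add: path2_sum_def)
  note walk = walk_entry_mult[OF assms(1)] sum_walk_entry[OF simple, folded d_def]
  show "trace (mat_power L 1) = 2 * m"
    using adj_self[OF simple] sd by (simp add: trace_def L1 walk_entry_def path2_def del: One_nat_def)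
  show "trace (mat_power L 2) = M1 E 2 + 2 * m"
    using tr[of 1 1] by (simp add: L1 walk es path_0 v0 del: One_nat_def)
  show "trace (mat_power L 3) = M1 E 3 + 3 * M1 E 2"
    using tr[of 1 2] by (simp add: L1 L2 walk es path_0 v1 del: One_nat_def)
  show "trace (mat_power L 4) = M1 E 4 + 4 * M1 E 3 + 2 * M1 E 2 + 4 * M2 E 1 - 2 * m"
    using tr[of 2 2] unfolding L2 walk minus_mult_minus by (simp add: c1 v2 p0)
  show "trace (mat_power L 5) = M1 E 5 + 5 * M1 E 4 + 5 * M1 E 3 - 5 * M1 E 2 + 5 * alpha E 1 2 + 10 * M2 E 1"
    using tr[of 2 3] unfolding L2 L3 walk minus_mult_minus by (simp add: c2 v3 ps)
  show "trace (mat_power L 6) = M1 E 6 + 6 * M1 E 5 + 9 * M1 E 4 - 4 * M1 E 3 - 6 * M1 E 2 + 4 * m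
       + 6 * alpha E 1 3 + 18 * alpha E 1 2 + 6 * M2 E 2 - 6 * M2 E 1 + 6 * Theta2 E"
    using tr[of 3 3] unfolding L3 walk minus_mult_minus by (simp add: c3 c4 v4 q1)
qed

section \<open>The sixth coefficient in terms of traces\<close>

text \<open>This is the expansion of 6! times the sixth elementary symmetric polynomial in power
  sums \<open>t k\<close>: each coefficient is the signed number of permutations of six points with
  the corresponding cycle type. The recursion is solved step by step, with denominators cleared by
  \<open>k!\<close>.\<close>

lemma newton_6:
  fixes q t :: "nat \<Rightarrow> real"
  assumes "q 0 = 1" and "\<And>k. k \<le> 6 \<Longrightarrow> real k * q k = - (\<Sum>i<k. q i * t (k - i))"
  shows "720 * q 6 = t 1 ^ 6 - 15 * t 1 ^ 4 * t 2 + 45 * t 1 ^ 2 * t 2 ^ 2 - 15 * t 2 ^ 3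
    + 40 * t 1 ^ 3 * t 3 - 120 * t 1 * t 2 * t 3 + 40 * t 3 ^ 2 - 90 * t 1 ^ 2 * t 4 + 90 * t 2 * t 4
    + 144 * t 1 * t 5 - 120 * t 6"
proof -
  have q1: "q 1 = - t 1"
    using assms(2)[of 1] assms(1) by simp
  have q2: "2 * q 2 = t 1 ^ 2 - t 2"
    using assms(2)[of 2] assms(1) q1 by (simp add: numeral_eq_Suc algebra_simps)
  have q3: "6 * q 3 = - (t 1 ^ 3) + 3 * t 1 * t 2 - 2 * t 3"
    using assms(2)[of 3] assms(1) q1 q2 by (simp add: lessThan_nat_numeral lessThan_Suc) algebra
  have q4: "24 * q 4 = t 1 ^ 4 - 6 * t 1 ^ 2 * t 2 + 3 * t 2 ^ 2 + 8 * t 1 * t 3 - 6 * t 4"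
    using assms(2)[of 4] assms(1) q1 q2 q3 by (simp add: lessThan_nat_numeral lessThan_Suc) algebra
  have q5: "120 * q 5 = - (t 1 ^ 5) + 10 * t 1 ^ 3 * t 2 - 15 * t 1 * t 2 ^ 2 - 20 * t 1 ^ 2 * t 3
      + 20 * t 2 * t 3 + 30 * t 1 * t 4 - 24 * t 5"
    using assms(2)[of 5] assms(1) q1 q2 q3 q4 by (simp add: lessThan_nat_numeral lessThan_Suc) algebra
  show ?thesis
    using assms(2)[of 6] assms(1) q1 q2 q3 q4 q5 by (simp add: lessThan_nat_numeral lessThan_Suc) algebra
qed

theorem theorem2p27:
  fixes E :: "'v::finite set set"
    and n m :: nat
    and c :: "nat \<Rightarrow> real"
  assumes "forest E"
    and "n = CARD('v)"
    and "m = card E"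
    and "laplacian_poly E = (\<Sum>k\<le>n. monom ((-1) ^ (n - k) * c k) k)"
    and "n \<ge> 6"
  shows "c (n - 6) = 1 / fact 6 *
    (64 * real m ^ 6 - 480 * real m ^ 5 + 720 * real m ^ 4 + 600 * real m ^ 3
     - 360 * real m ^ 2 - 480 * real m
     - 720 * M1 E 5 - 2160 * alpha E 1 2 - 720 * alpha E 1 3
     + 540 * (M1 E 2) ^ 2 - 2340 * real m ^ 2 * M1 E 2 + 2160 * real m * M1 E 3
     - 1080 * M1 E 4 + 720 * M2 E 1 - 240 * M1 E 2 * M1 E 3 * real m
     - 120 * M1 E 6 - 720 * M2 E 2 + 600 * M1 E 2 * M1 E 3
     + 1680 * M1 E 2 * real m ^ 3 - 810 * (M1 E 2) ^ 2 * real m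
     - 1920 * M1 E 3 * real m ^ 2 + 1620 * M1 E 4 * real m
     + 3600 * M2 E 1 * real m - 720 * Theta2 E - 1260 * real m * M1 E 2
     + 720 * M1 E 2 + 480 * M1 E 3 - 240 * real m ^ 4 * M1 E 2
     + 320 * real m ^ 3 * M1 E 3 + 360 * M1 E 2 * M2 E 1 + 90 * M1 E 2 * M1 E 4
     + 180 * (M1 E 2) ^ 2 * real m ^ 2 - 360 * M1 E 4 * real m ^ 2
     - 1440 * M2 E 1 * real m ^ 2 + 288 * M1 E 5 * real m
     + 1440 * alpha E 1 2 * real m + 40 * (M1 E 3) ^ 2 - 15 * (M1 E 2) ^ 3)" (is "_ = 1 / fact 6 * ?rhs")
proof -
  let ?L = "laplacian_matrix E"
  define q where "q k = coeff (laplacian_poly E) (n - k)" for k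
  define t where "t k = trace (mat_power ?L k)" for k
  have lap: "laplacian_poly E = det (char_mat ?L)"
    by (simp add: laplacian_poly_def char_mat_def)
  \<comment> \<open>As \<open>n \<ge> 6\<close>, the truncated difference \<open>n - (n - 6)\<close>
    is 6, and the sign is positive.\<close>
  have q6: "q 6 = c (n - 6)"
    using assms(5) by (simp add: q_def assms(4) coeff_sum)
  have "720 * q 6 = t 1 ^ 6 - 15 * t 1 ^ 4 * t 2 + 45 * t 1 ^ 2 * t 2 ^ 2 - 15 * t 2 ^ 3
    + 40 * t 1 ^ 3 * t 3 - 120 * t 1 * t 2 * t 3 + 40 * t 3 ^ 2 - 90 * t 1 ^ 2 * t 4 + 90 * t 2 * t 4
    + 144 * t 1 * t 5 - 120 * t 6"
  proof (rule newton_6)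
    show "q 0 = 1"
      by (simp add: q_def lap assms(2) det_char_mat_degree(2))
    show "real k * q k = - (\<Sum>i<k. q i * t (k - i))" if "k \<le> 6" for k
      using newton_identity_char_mat[of k ?L] that assms(2,5) by (simp add: q_def t_def lap)
  qed
  \<comment> \<open>With all traces replaced by their closed forms, a polynomial identity in the
    invariants remains.\<close>
  note * = this[unfolded t_def laplacian_traces[OF assms(1)] q6, folded assms(3)]
  have "720 * c (n - 6) = ?rhs"
    by (rule trans[OF *]) algebra
  then show ?thesis by (simp add: fact_numeral)
qed

end
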